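(* Let $O$ be a locally finite totally ordered set, and let $A,B\in\mathscr E_O$ with $A\ne 1$, $B\ne 0,1$ and $B$ finite, say $B=\{[\ell_i..r_i]: 0\le i<n\}$ with $\ell_0\sqsubset\ell_1\sqsubset\cdots\sqsubset\ell_{n-1}$. Let $T$ be the set of all $i$ with $0<i<n$ such that $\{[\ell_{i-1}+1..r_i-1]\}\le A$, and, if $T\ne\emptyset$, let $t_{\min}=\min T$, $t_{\max}=\max T$, $T^+=T\setminus\{t_{\min}\}$, and for $i\in T^+$ let $P(i)$ be the largest element of $T$ smaller than $i$. If $T\ne\emptyset$, then \[A\to B=U^-\cup\bigcup_{i\in T^+}\varepsilon(\ell_{i-1},r_{P(i)})\cup U^+,\] where $U^-=\varepsilon(\ell_{t_{\min}-1},r_0)$ if $\{(\leftarrow..r_0-1]\}\le A$ and $U^-=\widetilde{[\ell_{t_{\min}-1}+1..\rightarrow)}$ otherwise, and $U^+=\varepsilon(\ell_{n-1},r_{t_{\max}})$ if $\{[\ell_{n-1}+1..\rightarrow)\}\le A$ and $U^+=\widetilde{(\leftarrow..r_{t_{\max}}-1]}$ otherwise. If $T=\emptyset$, then $A\to B$ equals $\varepsilon(\ell_{n-1},r_0)$ if both $\{[\ell_{n-1}+1..\rightarrow)\}\le A$ and $\{(\leftarrow..r_0-1]\}\le A$; otherwise $\widetilde{[\ell_{n-1}+1..\rightarrow)}$ if $\{[\ell_{n-1}+1..\rightarrow)\}\le A$; otherwise $\widetilde{(\leftarrow..r_0-1]}$ if $\{(\leftarrow..r_0-1]\}\le A$;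 and $1$ otherwise.
   Context: $O=(O,\sqsubseteq)$ is a locally finite totally ordered set. An interval is a subset $I\subseteq O$ with $x\sqsubseteq z\sqsubseteq y$, $x,y\in I$ implying $z\in I$ (including $\emptyset$). Notation: $[\ell..r]=\{x:\ell\sqsubseteq x\sqsubseteq r\}$, $(\leftarrow..r]=\{x: x\sqsubseteq r\}$, $[\ell..\rightarrow)=\{x:\ell\sqsubseteq x\}$; $x+1$ and $x-1$ denote the successor and predecessor of $x$ in $O$; by convention $[\ell+1..\rightarrow)=\emptyset$ if $\ell$ has no successor and $(\leftarrow..r-1]=\emptyset$ if $r$ has no predecessor; $[x]=\{x\}$. $\mathscr I_O$ is the set of finite intervals. $\mathscr E_O$ is the set of inclusion-antichains of elements of $\mathscr I_O$, ordered by $A\le B$ iff for every $I\in A$ there is $J\in B$ with $J\subseteq I$; it is a complete distributive lattice (a Heyting algebra) with bottom $0=\emptyset$ and top $1=\{\emptyset\}$. For any interval $X$ (finite or not), $\{X\}\le A$ means that some interval of $A$ is contained in $X$. For an interval $I$, $\widetilde I=\{[x]: x\in O\setminus I\}$. For $\ell,r\in O$, $\varepsilon(\ell,r)=\{[\ell..r]\}$ if $\ell\sqsubset r$ and $\varepsilon(\ell,r)=\{[x]: r\sqsubseteq x\sqsubseteq\ell\}$ otherwise. $A\to B$ (relative pseudo-complement) is the greatest $C\in\mathscr E_O$ with $A\wedge C\le B$. *)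

theory Defs
  imports "HOL-Algebra.Complete_Lattice"
begin

definition order_interval :: "'a::linorder set \<Rightarrow> bool" where
  "order_interval I \<longleftrightarrow> (\<forall>x\<in>I. \<forall>y\<in>I. \<forall>z. x \<le> z \<and> z \<le> y \<longrightarrow> z \<in> I)"

definition finite_intervals :: "'a::linorder set set" where
  "finite_intervals = {I. order_interval I \<and> finite I}"

definition interval_antichains :: "'a::linorder set set set" where
  "interval_antichains =
     {A. A \<subseteq> finite_intervals \<and> (\<forall>I\<in>A. \<forall>J\<in>A. I \<subseteq> J \<longrightarrow> I = J)}"

text \<open>
  The relation \<open>le EO\<close> is meaningful also outside the carrier, so that
  \<open>{X} \<sqsubseteq>\<^bsub>EO\<^esub> A\<close> makes sense for infinite \<open>X\<close>.
\<close>

definition EO :: "'a::linorder set set gorder" where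
  "EO = \<lparr>carrier = interval_antichains, eq = (=),
         le = (\<lambda>A B. \<forall>I\<in>A. \<exists>J\<in>B. J \<subseteq> I)\<rparr>"

definition rel_pseudo_compl :: "'a::linorder set set \<Rightarrow> 'a set set \<Rightarrow> 'a set set"
    (infixr \<open>\<rightarrow>\<^sub>H\<close> 60) where
  "A \<rightarrow>\<^sub>H B = (THE C. greatest EO C {C \<in> carrier EO. A \<sqinter>\<^bsub>EO\<^esub> C \<sqsubseteq>\<^bsub>EO\<^esub> B})"

definition singletons_outside :: "'a::linorder set \<Rightarrow> 'a set set" where
  "singletons_outside I = {{x} | x. x \<notin> I}"

definition eps :: "'a::linorder \<Rightarrow> 'a \<Rightarrow> 'a set set" where
  "eps l r = (if l < r then {{l..r}} else {{x} | x. r \<le> x \<and> x \<le> l})"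


text \<open>
  The intervals \<open>[l+1..\<rightarrow>)\<close>, \<open>(\<leftarrow>..r-1]\<close> and \<open>[l+1..r-1]\<close> are written \<open>{l<..}\<close>, \<open>{..<r}\<close>
  and \<open>{l<..<r}\<close>. The next lemmas show that this agrees with the formulation in terms of
  successors and predecessors, including the convention for missing ones.
\<close>

lemma greaterThan_eq_atLeast_succ:
  fixes l s :: "'a::linorder"
  assumes "l < s" and "\<And>z. l < z \<Longrightarrow> s \<le> z"
  shows "{l<..} = {s..}"
  using assms by force

lemma lessThan_eq_atMost_pred:
  fixes r p :: "'a::linorder"
  assumes "p < r" and "\<And>z. z < r \<Longrightarrow> z \<le> p"
  shows "{..<r} = {..p}"
  using assms by force

lemma greaterThanLessThan_eq_succ_pred:
  fixes l s r p :: "'a::linorder"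
  assumes "l < s" and "\<And>z. l < z \<Longrightarrow> s \<le> z"
    and "p < r" and "\<And>z. z < r \<Longrightarrow> z \<le> p"
  shows "{l<..<r} = {s..p}"
  using assms by force

lemma no_succ_imp_greaterThan_empty:
  fixes l :: "'a::linorder"
  assumes fin: "\<And>a b :: 'a. finite {a..b}"
    and no: "\<nexists>s. l < s \<and> (\<forall>z. l < z \<longrightarrow> s \<le> z)"
  shows "{l<..} = {}"
proof (rule ccontr)
  assume "{l<..} \<noteq> {}"
  then obtain y where y: "l < y" by auto
  have f: "finite {l<..y}" by (rule finite_subset[OF _ fin[of l y]]) auto
  let ?s = "Min {l<..y}"
  have "?s \<in> {l<..y}" using f y by (intro Min_in) auto
  moreover have "?s \<le> z" if "l < z" for z
  proof (cases "z \<le> y")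
    case True
    then show ?thesis using f that by auto
  next
    case False
    then show ?thesis using calculation by auto
  qed
  ultimately show False using no by auto
qed

lemma no_pred_imp_lessThan_empty:
  fixes r :: "'a::linorder"
  assumes fin: "\<And>a b :: 'a. finite {a..b}"
    and no: "\<nexists>p. p < r \<and> (\<forall>z. z < r \<longrightarrow> z \<le> p)"
  shows "{..<r} = {}"
proof (rule ccontr)
  assume "{..<r} \<noteq> {}"
  then obtain y where y: "y < r" by auto
  have f: "finite {y..<r}" by (rule finite_subset[OF _ fin[of y r]]) auto
  let ?p = "Max {y..<r}"
  have "?p \<in> {y..<r}" using f y by (intro Max_in) auto
  moreover have "z \<le> ?p" if "z < r" for z
  proof (cases "y \<le> z")
    case True
    then show ?thesis using f that by auto
  next
    case False
    then show ?thesis using calculation by auto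
  qed
  ultimately show False using no by auto
qed


text \<open>
  \<open>EO\<close> is a complete lattice in which the relative pseudo-complement exists, so that the
  descriptions by choice operators above (the library's \<open>\<sqinter>\<close> and \<open>THE\<close>) denote the intended
  objects. Antichains correspond to upward closed sets of finite intervals, via minimal elements.
\<close>

definition up :: "'a::linorder set set \<Rightarrow> 'a set set" where
  "up A = {I \<in> finite_intervals. \<exists>J\<in>A. J \<subseteq> I}"

definition minimals :: "'a set set \<Rightarrow> 'a set set" where
  "minimals U = {I \<in> U. \<forall>J\<in>U. J \<subseteq> I \<longrightarrow> J = I}"

definition upclosed :: "'a::linorder set set \<Rightarrow> bool" where
  "upclosed U \<longleftrightarrow> U \<subseteq> finite_intervals \<and> (\<forall>I\<in>U. \<forall>J\<in>finite_intervals. I \<subseteq> J \<longrightarrow> J \<in> U)"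

lemma EO_simps [simp]:
  "carrier EO = interval_antichains"
  "(.=\<^bsub>EO\<^esub>) = (=)"
  by (simp_all add: EO_def)

lemma EO_le: "A \<sqsubseteq>\<^bsub>EO\<^esub> B \<longleftrightarrow> (\<forall>I\<in>A. \<exists>J\<in>B. J \<subseteq> I)"
  by (simp add: EO_def)

lemma upclosed_up: "upclosed (up A)"
  unfolding upclosed_def up_def by blast

lemma minimals_antichain: "upclosed U \<Longrightarrow> minimals U \<in> interval_antichains"
  unfolding upclosed_def minimals_def interval_antichains_def by blast

lemma minimals_below:
  assumes "U \<subseteq> finite_intervals" "I \<in> U"
  shows "\<exists>J\<in>minimals U. J \<subseteq> I"
proof -
  have "finite I" using assms by (auto simp: finite_intervals_def)
  then show ?thesis using assms(2)
  proof (induction I rule: finite_psubset_induct)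
    case (psubset I)
    show ?case
    proof (cases "\<exists>J\<in>U. J \<subset> I")
      case True
      then obtain J where J: "J \<in> U" "J \<subset> I" by blast
      then obtain K where "K \<in> minimals U" "K \<subseteq> J" using psubset.IH by blast
      then show ?thesis using J by blast
    next
      case False
      then have "I \<in> minimals U" using psubset.prems unfolding minimals_def by blast
      then show ?thesis by blast
    qed
  qed
qed

lemma up_minimals:
  assumes "upclosed U" shows "up (minimals U) = U"
proof
  show "up (minimals U) \<subseteq> U"
    using assms unfolding up_def minimals_def upclosed_def by blast
  show "U \<subseteq> up (minimals U)"
    using assms minimals_below[of U] unfolding up_def upclosed_def by blast
qed

lemma le_iff_up:
  assumes "A \<in> interval_antichains"
  shows "A \<sqsubseteq>\<^bsub>EO\<^esub> B \<longleftrightarrow> up A \<subseteq> up B"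
proof
  assume "A \<sqsubseteq>\<^bsub>EO\<^esub> B"
  then have *: "\<exists>K\<in>B. K \<subseteq> J" if "J \<in> A" for J using that by (simp add: EO_le)
  show "up A \<subseteq> up B"
  proof
    fix I assume "I \<in> up A"
    then obtain J where J: "I \<in> finite_intervals" "J \<in> A" "J \<subseteq> I" unfolding up_def by blast
    then obtain K where "K \<in> B" "K \<subseteq> J" using * by blast
    then show "I \<in> up B" using J unfolding up_def by blast
  qed
next
  assume "up A \<subseteq> up B"
  moreover have "A \<subseteq> up A" using assms unfolding up_def interval_antichains_def by blast
  ultimately have "A \<subseteq> up B" by blast
  then show "A \<sqsubseteq>\<^bsub>EO\<^esub> B" unfolding EO_le up_def by blast
qed

interpretation EO: partial_order EO
proof
  fix A B :: "'a set set"
  assume AB: "A \<sqsubseteq>\<^bsub>EO\<^esub> B" "B \<sqsubseteq>\<^bsub>EO\<^esub> A" and c: "A \<in> carrier EO" "B \<in> carrier EO"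
  have *: "C \<subseteq> D" if CD: "C \<sqsubseteq>\<^bsub>EO\<^esub> D" "D \<sqsubseteq>\<^bsub>EO\<^esub> C" "C \<in> carrier EO" for C D :: "'a set set"
  proof
    fix I assume I: "I \<in> C"
    then obtain J where J: "J \<in> D" "J \<subseteq> I" using CD(1) unfolding EO_le by blast
    then obtain K where K: "K \<in> C" "K \<subseteq> J" using CD(2) unfolding EO_le by blast
    then have "K = I" using CD(3) I J(2) unfolding interval_antichains_def EO_simps by blast
    then have "J = I" using J K by blast
    then show "I \<in> D" using J by simp
  qed
  show "A .=\<^bsub>EO\<^esub> B" using *[OF AB c(1)] *[OF AB(2,1) c(2)] by simp
next
  fix A B C :: "'a set set"
  assume "A \<sqsubseteq>\<^bsub>EO\<^esub> B" "B \<sqsubseteq>\<^bsub>EO\<^esub> C"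
  then show "A \<sqsubseteq>\<^bsub>EO\<^esub> C" unfolding EO_le by (meson order_trans)
qed (auto simp: EO_le)

lemma upclosed_Union: "(\<And>U. U \<in> \<U> \<Longrightarrow> upclosed U) \<Longrightarrow> upclosed (\<Union>\<U>)"
  unfolding upclosed_def by blast

lemma upclosed_Inter: "(\<And>U. U \<in> \<U> \<Longrightarrow> upclosed U) \<Longrightarrow> upclosed (finite_intervals \<inter> \<Inter>\<U>)"
  unfolding upclosed_def by blast

interpretation EO: complete_lattice EO
proof
  fix \<A> :: "'a set set set"
  assume sub: "\<A> \<subseteq> carrier EO"
  let ?U = "\<Union>(up ` \<A>)" and ?I = "finite_intervals \<inter> \<Inter>(up ` \<A>)"
  have U: "upclosed ?U" "minimals ?U \<in> interval_antichains" "up (minimals ?U) = ?U"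
    using upclosed_up upclosed_Union[of "up ` \<A>"] minimals_antichain up_minimals by blast+
  have I: "upclosed ?I" "minimals ?I \<in> interval_antichains" "up (minimals ?I) = ?I"
    using upclosed_up upclosed_Inter[of "up ` \<A>"] minimals_antichain up_minimals by blast+
  have fi: "up A \<subseteq> finite_intervals" for A :: "'a set set" by (auto simp: up_def)
  show "\<exists>s. least EO s (Upper EO \<A>)"
  proof
    show "least EO (minimals ?U) (Upper EO \<A>)"
    proof (rule least_UpperI)
      fix A assume "A \<in> \<A>"
      then show "A \<sqsubseteq>\<^bsub>EO\<^esub> minimals ?U" using le_iff_up[of A "minimals ?U"] sub U(3) by auto
    next
      fix B assume B: "B \<in> Upper EO \<A>"
      have "up A \<subseteq> up B" if "A \<in> \<A>" for A
        using that B sub le_iff_up[of A B] unfolding Upper_def by auto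
      then show "minimals ?U \<sqsubseteq>\<^bsub>EO\<^esub> B" using le_iff_up[OF U(2)] U(3) by auto
    qed (use sub U in auto)
  qed
  show "\<exists>s. greatest EO s (Lower EO \<A>)"
  proof
    show "greatest EO (minimals ?I) (Lower EO \<A>)"
    proof (rule greatest_LowerI)
      fix A assume "A \<in> \<A>"
      then show "minimals ?I \<sqsubseteq>\<^bsub>EO\<^esub> A" using le_iff_up[OF I(2)] I(3) by auto
    next
      fix B assume B: "B \<in> Lower EO \<A>"
      have "up B \<subseteq> up A" if "A \<in> \<A>" for A
        using that B sub le_iff_up[of B A] unfolding Lower_def by auto
      moreover have "B \<in> interval_antichains" using B unfolding Lower_def by simp
      ultimately show "B \<sqsubseteq>\<^bsub>EO\<^esub> minimals ?I" using le_iff_up[of B] I(3) fi by auto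
    qed (use sub I in auto)
  qed
qed

lemma bottom_EO: "\<bottom>\<^bsub>EO\<^esub> = {}"
proof (rule EO.least_unique[OF EO.bottom_least])
  show "least EO {} (carrier EO)"
    by (auto simp: least_def EO_le interval_antichains_def)
qed

lemma top_EO: "\<top>\<^bsub>EO\<^esub> = {{}}"
proof (rule EO.greatest_unique[OF EO.top_greatest])
  show "greatest EO {{}} (carrier EO)"
    by (auto simp: greatest_def EO_le interval_antichains_def finite_intervals_def
        order_interval_def)
qed

lemma up_meet:
  assumes "A \<in> interval_antichains" "B \<in> interval_antichains"
  shows "up (A \<sqinter>\<^bsub>EO\<^esub> B) = up A \<inter> up B"
proof -
  have m: "A \<sqinter>\<^bsub>EO\<^esub> B \<in> interval_antichains" using assms EO.meet_closed by simp
  have "A \<sqinter>\<^bsub>EO\<^esub> B \<sqsubseteq>\<^bsub>EO\<^esub> A" "A \<sqinter>\<^bsub>EO\<^esub> B \<sqsubseteq>\<^bsub>EO\<^esub> B"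
    using EO.meet_left[of A B] EO.meet_right[of A B] assms by simp_all
  then have 1: "up (A \<sqinter>\<^bsub>EO\<^esub> B) \<subseteq> up A \<inter> up B" using le_iff_up[OF m] by blast
  let ?C = "minimals (up A \<inter> up B)"
  have u: "upclosed (up A \<inter> up B)" using upclosed_up[of A] upclosed_up[of B]
    unfolding upclosed_def by blast
  have C: "?C \<in> interval_antichains" "up ?C = up A \<inter> up B"
    using minimals_antichain[OF u] up_minimals[OF u] .
  have "?C \<sqsubseteq>\<^bsub>EO\<^esub> A" "?C \<sqsubseteq>\<^bsub>EO\<^esub> B" using le_iff_up[OF C(1)] C(2) by blast+
  then have "?C \<sqsubseteq>\<^bsub>EO\<^esub> A \<sqinter>\<^bsub>EO\<^esub> B" using EO.meet_le[of ?C A B] assms C by simp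
  then show ?thesis using 1 le_iff_up[OF C(1)] C(2) by blast
qed

lemma rel_pseudo_compl_exists:
  assumes A: "A \<in> interval_antichains" and B: "B \<in> interval_antichains"
  shows "\<exists>!C. greatest EO C {C \<in> carrier EO. A \<sqinter>\<^bsub>EO\<^esub> C \<sqsubseteq>\<^bsub>EO\<^esub> B}"
proof (rule ex_ex1I)
  let ?S = "{C \<in> carrier EO. A \<sqinter>\<^bsub>EO\<^esub> C \<sqsubseteq>\<^bsub>EO\<^esub> B}"
  let ?U = "{I \<in> finite_intervals. \<forall>J\<in>finite_intervals. I \<subseteq> J \<longrightarrow> J \<in> up A \<longrightarrow> J \<in> up B}"
  have u: "upclosed ?U" unfolding upclosed_def by blast
  have C: "minimals ?U \<in> interval_antichains" "up (minimals ?U) = ?U"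
    using minimals_antichain[OF u] up_minimals[OF u] .
  have S: "D \<in> ?S \<longleftrightarrow> D \<in> interval_antichains \<and> up A \<inter> up D \<subseteq> up B" for D
    using le_iff_up[of "A \<sqinter>\<^bsub>EO\<^esub> D" B] EO.meet_closed[of A D] up_meet[OF A, of D] A
    by auto
  have "up D \<subseteq> ?U" if "up A \<inter> up D \<subseteq> up B" for D
    using that upclosed_up[of D] unfolding upclosed_def by blast
  moreover have "up A \<inter> ?U \<subseteq> up B" by blast
  ultimately have "greatest EO (minimals ?U) ?S"
    using C S le_iff_up unfolding greatest_def
    by (metis (no_types, lifting) EO_simps(1) mem_Collect_eq subsetI)
  then show "\<exists>C. greatest EO C ?S" by blast
qed (rule EO.greatest_unique)

lemma rel_pseudo_compl_greatest:
  assumes "A \<in> interval_antichains" "B \<in> interval_antichains"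
  shows "greatest EO (A \<rightarrow>\<^sub>H B) {C \<in> carrier EO. A \<sqinter>\<^bsub>EO\<^esub> C \<sqsubseteq>\<^bsub>EO\<^esub> B}"
  unfolding rel_pseudo_compl_def by (rule theI'[OF rel_pseudo_compl_exists[OF assms]])

end

theory Submission
  imports Defs
begin

text \<open>
  The finite intervals that contain no member of \<open>B\<close> are those contained in one
  of \<open>n + 1\<close> gaps: \<open>(\<leftarrow>..r\<^sub>0-1]\<close>, the \<open>[l\<^sub>i\<^sub>-\<^sub>1+1..r\<^sub>i-1]\<close>, and \<open>[l\<^sub>n\<^sub>-\<^sub>1+1..\<rightarrow>)\<close>. Two finite
  intervals in the same gap have their hull in it, so a finite interval \<open>I\<close> lies above
  a member of \<open>A \<rightarrow> B\<close> iff it is not contained in any gap that contains an interval of \<open>A\<close>. Writing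
  those gaps in increasing order, a minimal such \<open>I\<close> is either a point that avoids all
  of them or runs from the left end of one of them to the right end of the preceding one.
\<close>

section \<open>Relative pseudo-complements through up-sets, and hulls of finite intervals\<close>

text \<open>\<open>up\<close> turns the order into inclusion and meets into intersections. The
  right-hand side of the last hypothesis is the largest upward closed set whose intersection with
  \<open>up A\<close> lies in \<open>up B\<close>, so an antichain generating it is the greatest
  candidate.\<close>

lemma rel_pseudo_compl_eqI:
  assumes A: "A \<in> interval_antichains" and B: "B \<in> interval_antichains"
    and C: "C \<in> interval_antichains"
    and up: "up C = {I \<in> finite_intervals.
      \<forall>J\<in>finite_intervals. I \<subseteq> J \<longrightarrow> J \<in> up A \<longrightarrow> J \<in> up B}"
  shows "A \<rightarrow>\<^sub>H B = C"
proof -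
  let ?S = "{C \<in> carrier EO. A \<sqinter>\<^bsub>EO\<^esub> C \<sqsubseteq>\<^bsub>EO\<^esub> B}"
  have S: "D \<in> ?S \<longleftrightarrow> D \<in> interval_antichains \<and> up A \<inter> up D \<subseteq> up B" for D
    using le_iff_up[of "A \<sqinter>\<^bsub>EO\<^esub> D" B] EO.meet_closed[of A D] up_meet[OF A, of D] A
    by auto
  have "up D \<subseteq> up C" if "up A \<inter> up D \<subseteq> up B" for D
    unfolding up using that upclosed_up[of D] unfolding upclosed_def by blast
  moreover have "up A \<inter> up C \<subseteq> up B"
    unfolding up by blast
  ultimately have "greatest EO C ?S"
    using C S le_iff_up unfolding greatest_def
    by (metis (no_types, lifting) EO_simps(1) mem_Collect_eq subsetI)
  then show ?thesis
    unfolding rel_pseudo_compl_def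
    by (intro the1_equality[OF rel_pseudo_compl_exists[OF A B]])
qed

lemma order_interval_atLeastAtMost_subset:
  "order_interval X \<Longrightarrow> a \<in> X \<Longrightarrow> b \<in> X \<Longrightarrow> {a..b} \<subseteq> X"
  unfolding order_interval_def by (meson atLeastAtMost_iff subsetI)

lemma finite_intervals_hull:
  fixes I J :: "'a::linorder set"
  assumes locally_finite: "\<And>a b :: 'a. finite {a..b}"
    and "I \<in> finite_intervals" "J \<in> finite_intervals" "order_interval X" "I \<subseteq> X" "J \<subseteq> X"
  obtains K where "K \<in> finite_intervals" "I \<subseteq> K" "J \<subseteq> K" "K \<subseteq> X"
proof (cases "I \<union> J = {}")
  \<comment> \<open>\<open>Min\<close> and \<open>Max\<close> of the empty set are unspecified, so
    two empty intervals get the empty hull separately.\<close>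
  case True
  then show ?thesis using that[of "{}"] by (auto simp: finite_intervals_def order_interval_def)
next
  case False
  let ?K = "{Min (I \<union> J)..Max (I \<union> J)}"
  have fin: "finite (I \<union> J)" using assms by (auto simp: finite_intervals_def)
  have "Min (I \<union> J) \<in> X" "Max (I \<union> J) \<in> X"
    using Min_in[OF fin False] Max_in[OF fin False] assms by auto
  then have "?K \<subseteq> X" using \<open>order_interval X\<close> order_interval_atLeastAtMost_subset by blast
  moreover have "I \<subseteq> ?K" "J \<subseteq> ?K" using fin by auto
  moreover have "?K \<in> finite_intervals"
    using locally_finite by (auto simp: finite_intervals_def order_interval_def)
  ultimately show ?thesis using that by blast
qed

section \<open>Neighbouring elements of a finite set of natural numbers\<close>

text \<open>Coding neighbours as pairs puts the end gaps \<open>0\<close> and \<open>n\<close> on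
  the same footing as the elements of \<open>T\<close>, for which alone the predecessor P(i) is
  given.\<close>

definition consecutive :: "nat set \<Rightarrow> (nat \<times> nat) set" where
  "consecutive S = {(g, h). g \<in> S \<and> h \<in> S \<and> g < h \<and> (\<forall>k\<in>S. k \<le> g \<or> h \<le> k)}"

text \<open>A new least element has only one neighbour, the old minimum, and separates no old pair.
  This serves to add gap \<open>0\<close> to \<open>T\<close>; the dual lemma adds gap
  \<open>n\<close>.\<close>

lemma consecutive_insert_less:
  assumes "finite S" "S \<noteq> {}" "\<And>s. s \<in> S \<Longrightarrow> m < s"
  shows "consecutive (insert m S) = insert (m, Min S) (consecutive S)"
proof -
  have M: "Min S \<in> S" "\<And>s. s \<in> S \<Longrightarrow> Min S \<le> s" using assms by auto
  have "h = Min S" if "(m, h) \<in> consecutive (insert m S)" for h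
    using that M assms(3) unfolding consecutive_def
    by (auto dest: assms(3)) (metis assms(3) leD le_antisym)
  then show ?thesis
    using M assms(3) unfolding consecutive_def
    by (auto simp: less_imp_le dest: assms(3))
qed

lemma consecutive_insert_greater:
  assumes "finite S" "S \<noteq> {}" "\<And>s. s \<in> S \<Longrightarrow> s < m"
  shows "consecutive (insert m S) = insert (Max S, m) (consecutive S)"
proof -
  have M: "Max S \<in> S" "\<And>s. s \<in> S \<Longrightarrow> s \<le> Max S" using assms by auto
  have "g = Max S" if "(g, m) \<in> consecutive (insert m S)" for g
    using that M assms(3) unfolding consecutive_def
    by (auto dest: assms(3)) (metis assms(3) leD le_antisym)
  then show ?thesis
    using M assms(3) unfolding consecutive_def
    by (auto simp: less_imp_le dest: assms(3))
qed

lemma consecutive_singleton [simp]: "consecutive {m} = {}"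
  by (auto simp: consecutive_def)

lemma consecutive_predecessor:
  assumes "finite S" "g \<in> S" "h \<in> S" "g < h"
  shows "(Max {k \<in> S. k < h}, h) \<in> consecutive S"
proof -
  have "Max {k \<in> S. k < h} \<in> {k \<in> S. k < h}" using assms by (intro Max_in) auto
  moreover have "k \<le> Max {k \<in> S. k < h}" if "k \<in> S" "k < h" for k
    using that assms(1) by (intro Max_ge) auto
  ultimately show ?thesis
    using assms(3) unfolding consecutive_def by (auto simp: not_less[symmetric])
qed

lemma consecutive_successor:
  assumes "finite S" "g \<in> S" "h \<in> S" "g < h"
  obtains k where "(g, k) \<in> consecutive S"
proof -
  let ?k = "Min {k \<in> S. g < k}"
  have "?k \<in> {k \<in> S. g < k}" using assms by (intro Min_in) auto
  moreover have "?k \<le> k" if "k \<in> S" "g < k" for k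
    using that assms(1) by (intro Min_le) auto
  ultimately have "(g, ?k) \<in> consecutive S"
    using assms(2) unfolding consecutive_def by (auto simp: not_less[symmetric])
  then show ?thesis by (rule that)
qed

lemma consecutive_inj: "(g, h) \<in> consecutive S \<Longrightarrow> (g', h) \<in> consecutive S \<Longrightarrow> g = g'"
  unfolding consecutive_def by force

text \<open>Every element except the minimum has exactly one predecessor. This translates
  neighbouring pairs into the index set T^+ with its map P.\<close>

lemma consecutive_eq:
  assumes "finite S" "S \<noteq> {}"
  shows "consecutive S = (\<lambda>h. (Max {k \<in> S. k < h}, h)) ` (S - {Min S})"
proof (intro equalityI subsetI)
  fix p assume p: "p \<in> consecutive S"
  obtain g h where gh: "p = (g, h)" by (cases p)
  have h: "g \<in> S" "h \<in> S" "g < h" using p gh by (auto simp: consecutive_def)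
  then have "(Max {k \<in> S. k < h}, h) \<in> consecutive S" using assms consecutive_predecessor by blast
  then have "g = Max {k \<in> S. k < h}" using p gh consecutive_inj by blast
  moreover have "h \<noteq> Min S" using h assms by (metis Min_le leD)
  ultimately show "p \<in> (\<lambda>h. (Max {k \<in> S. k < h}, h)) ` (S - {Min S})" using gh h by auto
next
  fix p assume "p \<in> (\<lambda>h. (Max {k \<in> S. k < h}, h)) ` (S - {Min S})"
  then obtain h where h: "h \<in> S" "h \<noteq> Min S" "p = (Max {k \<in> S. k < h}, h)" by auto
  have "Min S \<in> S" "Min S < h" using h assms by (auto simp: order_less_le)
  then show "p \<in> consecutive S" using consecutive_predecessor assms(1) h by blast
qed

section \<open>Chains of intervals and their gaps\<close>

text \<open>Growth of the right ends is assumed here; the theorem derives it from the growth of the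
  left ends and the antichain condition on \<open>B\<close>.\<close>

locale interval_chain =
  fixes l r :: "nat \<Rightarrow> 'a::linorder" and n :: nat
  assumes locally_finite: "\<And>a b :: 'a. finite {a..b}"
    and l_less: "\<And>i j. i < j \<Longrightarrow> j < n \<Longrightarrow> l i < l j"
    and r_less: "\<And>i j. i < j \<Longrightarrow> j < n \<Longrightarrow> r i < r j"
    and l_le_r: "\<And>i. i < n \<Longrightarrow> l i \<le> r i"
begin

text \<open>The guards \<open>0 < g\<close> here and \<open>g < n\<close> in \<open>right\<close>
  make \<open>left 0\<close> and \<open>right n\<close> empty, so that one formula for
  \<open>gap\<close> covers the two end gaps as well as the middle ones.\<close>

definition left :: "nat \<Rightarrow> 'a set" where
  "left g = {x. 0 < g \<and> x \<le> l (g - 1)}"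

definition right :: "nat \<Rightarrow> 'a set" where
  "right g = {x. g < n \<and> r g \<le> x}"

definition gap :: "nat \<Rightarrow> 'a set" where
  "gap g = - (left g \<union> right g)"

text \<open>The outer sets supply the points lying in \<open>left k\<close> for all \<open>k\<close>
  in \<open>S\<close>, or in \<open>right k\<close> for all of them. They vanish if \<open>0\<close>
  or \<open>n\<close>, respectively, belongs to \<open>S\<close>, which produces the case
  distinctions in U^- and U^+.\<close>

definition separators :: "nat set \<Rightarrow> 'a set set" where
  "separators S = (\<lambda>x. {x}) ` left (Min S) \<union> (\<Union>(g, h)\<in>consecutive S. eps (l (h - 1)) (r g))
     \<union> (\<lambda>x. {x}) ` right (Max S)"

lemma l_mono: "i \<le> j \<Longrightarrow> j < n \<Longrightarrow> l i \<le> l j"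
  using l_less[of i j] by (cases "i = j") auto

lemma r_mono: "i \<le> j \<Longrightarrow> j < n \<Longrightarrow> r i \<le> r j"
  using r_less[of i j] by (cases "i = j") auto

lemma left_mono: "g \<le> h \<Longrightarrow> h \<le> n \<Longrightarrow> left g \<subseteq> left h"
proof
  fix x assume "g \<le> h" "h \<le> n" "x \<in> left g"
  moreover from this have "l (g - 1) \<le> l (h - 1)" by (intro l_mono) (auto simp: left_def)
  ultimately show "x \<in> left h" by (auto simp: left_def)
qed

lemma right_antimono: "g \<le> h \<Longrightarrow> h \<le> n \<Longrightarrow> right h \<subseteq> right g"
  using r_mono[of g h] by (auto simp: right_def)

lemma left_downward: "x \<in> left g \<Longrightarrow> y \<le> x \<Longrightarrow> y \<in> left g"
  by (auto simp: left_def)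

lemma right_upward: "x \<in> right g \<Longrightarrow> x \<le> y \<Longrightarrow> y \<in> right g"
  by (auto simp: right_def)

lemma order_interval_gap: "order_interval (gap g)"
  unfolding order_interval_def gap_def using left_downward right_upward by blast

lemma interval_in_finite_intervals: "{a..b::'a} \<in> finite_intervals"
  using locally_finite by (auto simp: finite_intervals_def order_interval_def)

lemma singleton_in_finite_intervals: "{a::'a} \<in> finite_intervals"
  using interval_in_finite_intervals[of a a] by simp

text \<open>If \<open>J\<close> contains the \<open>i\<close>-th interval, its point
  \<open>r i\<close> keeps it out of the gaps up to \<open>i\<close>, and \<open>l i\<close> out of
  the later ones. Conversely, a \<open>J\<close> that fits into no gap overruns the right end of the
  gap in which it starts.\<close>

lemma up_iff_not_in_gap:
  assumes J: "J \<in> finite_intervals" "J \<noteq> {}"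
  shows "J \<in> up {{l i..r i} | i. i < n} \<longleftrightarrow> \<not> (\<exists>g\<le>n. J \<subseteq> gap g)"
proof
  assume "J \<in> up {{l i..r i} | i. i < n}"
  then obtain i where i: "i < n" "{l i..r i} \<subseteq> J" by (auto simp: up_def)
  then have J: "l i \<in> J" "r i \<in> J" using l_le_r[of i] by auto
  show "\<not> (\<exists>g\<le>n. J \<subseteq> gap g)"
  proof safe
    fix g assume g: "g \<le> n" "J \<subseteq> gap g"
    show False
    proof (cases "g \<le> i")
      case True
      then have "r i \<in> right g" using r_mono[of g i] i by (auto simp: right_def)
      then show False using J g by (auto simp: gap_def)
    next
      case False
      then have "l i \<in> left g" using l_mono[of i "g - 1"] g by (auto simp: left_def)
      then show False using J g by (auto simp: gap_def)
    qed
  qed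
next
  assume *: "\<not> (\<exists>g\<le>n. J \<subseteq> gap g)"
  have fin: "finite J" using J by (auto simp: finite_intervals_def)
  let ?a = "Min J" and ?b = "Max J"
  have ab: "?a \<in> J" "?b \<in> J" using fin J by auto
  \<comment> \<open>The first gap whose right neighbour in the chain does not start before
    \<open>J\<close>; the alternative \<open>n <= g\<close> supplies the last gap if there is no
    such neighbour. Minimality keeps \<open>J\<close> disjoint from \<open>left g\<close>.\<close>
  define g where "g = (LEAST g. n \<le> g \<or> ?a \<le> l g)"
  have g: "n \<le> g \<or> ?a \<le> l g" unfolding g_def by (rule LeastI[of _ n]) simp
  have gn: "g \<le> n" unfolding g_def by (rule Least_le) simp
  have "?a \<notin> left g"
  proof
    assume "?a \<in> left g"
    then have "0 < g" "?a \<le> l (g - 1)" by (auto simp: left_def)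
    moreover from this have "g \<le> g - 1" using Least_le[of "\<lambda>g. n \<le> g \<or> ?a \<le> l g" "g - 1"]
      unfolding g_def by auto
    ultimately show False by simp
  qed
  then have "x \<notin> left g" if "x \<in> J" for x using that fin left_downward Min_le by blast
  then obtain x where "x \<in> J" "x \<in> right g" using * gn unfolding gap_def by blast
  then have "?b \<in> right g" using fin right_upward Max_ge by blast
  then have "g < n" "?a \<le> l g" "r g \<le> ?b" using g by (auto simp: right_def)
  then have "{l g..r g} \<subseteq> {?a..?b}" by auto
  also have "\<dots> \<subseteq> J" using J ab order_interval_atLeastAtMost_subset by (auto simp only: finite_intervals_def)
  finally show "J \<in> up {{l i..r i} | i. i < n}" using J \<open>g < n\<close> by (auto simp: up_def)
qed

text \<open>If \<open>I\<close> shares a gap with a member of \<open>A\<close>, the hull of the two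
  is above both but still in the gap, hence above no member of the chain. Conversely, a gap
  containing a \<open>J\<close> from \<open>up A\<close> with \<open>I\<close> inside
  \<open>J\<close> contains a member of \<open>A\<close> as well as \<open>I\<close>.\<close>

lemma heyting_up_iff:
  assumes A: "A \<in> interval_antichains" "{} \<notin> A" and I: "I \<in> finite_intervals"
  shows "(\<forall>J\<in>finite_intervals. I \<subseteq> J \<longrightarrow> J \<in> up A \<longrightarrow> J \<in> up {{l i..r i} | i. i < n})
    \<longleftrightarrow> (\<forall>g\<le>n. {gap g} \<sqsubseteq>\<^bsub>EO\<^esub> A \<longrightarrow> \<not> I \<subseteq> gap g)"
proof safe
  fix g assume *: "\<forall>J\<in>finite_intervals. I \<subseteq> J \<longrightarrow> J \<in> up A \<longrightarrow> J \<in> up {{l i..r i} | i. i < n}"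
    and g: "g \<le> n" "{gap g} \<sqsubseteq>\<^bsub>EO\<^esub> A" "I \<subseteq> gap g"
  obtain K where K: "K \<in> A" "K \<subseteq> gap g" using g by (auto simp: EO_le)
  then have "K \<in> finite_intervals" "K \<noteq> {}" using A by (auto simp: interval_antichains_def)
  then obtain J where J: "J \<in> finite_intervals" "I \<subseteq> J" "K \<subseteq> J" "J \<subseteq> gap g"
    using finite_intervals_hull[OF locally_finite I _ order_interval_gap g(3) K(2)] by metis
  then have "J \<in> up A" "J \<noteq> {}" using K \<open>K \<noteq> {}\<close> by (auto simp: up_def)
  then show False using * J up_iff_not_in_gap[of J] g by blast
next
  fix J assume *: "\<forall>g\<le>n. {gap g} \<sqsubseteq>\<^bsub>EO\<^esub> A \<longrightarrow> \<not> I \<subseteq> gap g"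
    and J: "J \<in> finite_intervals" "I \<subseteq> J" "J \<in> up A"
  obtain K where K: "K \<in> A" "K \<subseteq> J" using J by (auto simp: up_def)
  then have "J \<noteq> {}" using A by auto
  moreover have "\<not> J \<subseteq> gap g" if "g \<le> n" for g
  proof
    assume "J \<subseteq> gap g"
    then have "{gap g} \<sqsubseteq>\<^bsub>EO\<^esub> A" using K by (auto simp: EO_le)
    then show False using * that J \<open>J \<subseteq> gap g\<close> by blast
  qed
  ultimately show "J \<in> up {{l i..r i} | i. i < n}" using up_iff_not_in_gap J by blast
qed

text \<open>Such a point lies in \<open>right g\<close>, which excludes the gaps up to
  \<open>g\<close>, and in \<open>left h\<close>, which excludes those from \<open>h\<close> on;
  \<open>S\<close> has no index in between.\<close>

lemma between_consecutive_not_in_gap: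
  assumes S: "S \<subseteq> {..n}" and c: "(g, h) \<in> consecutive S" and x: "r g \<le> x" "x \<le> l (h - 1)"
    and k: "k \<in> S"
  shows "x \<notin> gap k"
proof -
  have gh: "g < h" "h \<le> n" using S c by (auto simp: consecutive_def)
  have "k \<le> g \<or> h \<le> k" using c k by (auto simp: consecutive_def)
  moreover have "x \<in> right g" "x \<in> left h" using gh x by (auto simp: left_def right_def)
  moreover have "k \<le> n" using S k by auto
  ultimately show ?thesis
    using left_mono[of h k] right_antimono[of k g] gh unfolding gap_def by auto
qed

section \<open>The separators as an antichain of generators\<close>

lemma separators_cases:
  assumes S: "finite S" "S \<noteq> {}" "S \<subseteq> {..n}" and I: "I \<in> separators S"
  obtains (point) x where "I = {x}" "\<And>k. k \<in> S \<Longrightarrow> x \<notin> gap k"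
  | (interval) g h where "(g, h) \<in> consecutive S" "l (h - 1) < r g" "I = {l (h - 1)..r g}"
proof -
  consider x where "I = {x}" "x \<in> left (Min S)" | x where "I = {x}" "x \<in> right (Max S)"
    | g h where "(g, h) \<in> consecutive S" "I \<in> eps (l (h - 1)) (r g)"
    using I unfolding separators_def by blast
  then show ?thesis
  proof cases
    case 1
    have "x \<notin> gap k" if "k \<in> S" for k
      using 1 left_mono[of "Min S" k] that S unfolding gap_def by auto
    then show ?thesis using 1 point by blast
  next
    case 2
    have "x \<notin> gap k" if "k \<in> S" for k
      using 2 right_antimono[of k "Max S"] that S Max_in[of S] unfolding gap_def by auto
    then show ?thesis using 2 point by blast
  next
    case 3
    show ?thesis
    proof (cases "l (h - 1) < r g")
      case True
      then show ?thesis using 3 interval by (auto simp: eps_def)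
    next
      case False
      then obtain x where "I = {x}" "r g \<le> x" "x \<le> l (h - 1)" using 3 by (auto simp: eps_def)
      then show ?thesis using point between_consecutive_not_in_gap[OF S(3) 3(1)] by blast
    qed
  qed
qed

lemma separators_below:
  assumes S: "finite S" "S \<noteq> {}" "S \<subseteq> {..n}" and I: "I \<in> finite_intervals"
    and *: "\<And>k. k \<in> S \<Longrightarrow> \<not> I \<subseteq> gap k"
  shows "\<exists>J\<in>separators S. J \<subseteq> I"
proof -
  have ne: "I \<noteq> {}" using S * by blast
  have fin: "finite I" using I by (auto simp: finite_intervals_def)
  let ?a = "Min I" and ?b = "Max I"
  have ab: "?a \<in> I" "?b \<in> I" using fin ne by auto
  show ?thesis
  proof (cases "?a \<in> left (Min S)")
    case True
    then have "{?a} \<in> separators S" by (auto simp: separators_def)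
    then show ?thesis using ab by blast
  next
    case False
    \<comment> \<open>the last gap starting to the left of \<open>I\<close>: \<open>I\<close> can leave it only at its right end\<close>
    define g where "g = Max {k \<in> S. ?a \<notin> left k}"
    have "g \<in> {k \<in> S. ?a \<notin> left k}"
      unfolding g_def
    proof (rule Max_in)
      show "{k \<in> S. ?a \<notin> left k} \<noteq> {}" using False Min_in[OF S(1,2)] by blast
    qed (use S(1) in simp)
    then have g: "g \<in> S" "?a \<notin> left g" by auto
    have g_max: "?a \<in> left k" if "k \<in> S" "g < k" for k
      using that S(1) Max_ge[of "{k \<in> S. ?a \<notin> left k}" k] unfolding g_def by fastforce
    have "x \<notin> left g" if "x \<in> I" for x using that g fin left_downward Min_le by blast
    then obtain x where "x \<in> I" "x \<in> right g" using *[OF g(1)] unfolding gap_def by blast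
    then have b: "?b \<in> right g" using fin right_upward Max_ge by blast
    show ?thesis
    proof (cases "g = Max S")
      case True
      then have "{?b} \<in> separators S" using b by (auto simp: separators_def)
      then show ?thesis using ab by blast
    next
      case False
      then have "g < Max S" using S g by (auto simp: order_less_le)
      then obtain h where gh: "(g, h) \<in> consecutive S"
        using consecutive_successor[OF S(1) g(1) Max_in] S by blast
      have eps: "eps (l (h - 1)) (r g) \<subseteq> separators S"
        using gh unfolding separators_def by blast
      \<comment> \<open>By the maximality of \<open>g\<close> the next gap \<open>h\<close> starts
        only to the right of \<open>?a\<close>, so \<open>I\<close> reaches from at most
        \<open>l (h - 1)\<close> to at least \<open>r g\<close>.\<close>
      have "?a \<in> left h" using g_max gh by (auto simp: consecutive_def)
      then have ends: "?a \<le> l (h - 1)" "r g \<le> ?b" using b by (auto simp: left_def right_def)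
      have sub: "{?a..?b} \<subseteq> I" using I ab order_interval_atLeastAtMost_subset
        by (auto simp only: finite_intervals_def)
      show ?thesis
      proof (cases "l (h - 1) < r g")
        case True
        then have "{l (h - 1)..r g} \<in> separators S" using eps by (auto simp: eps_def)
        moreover have "{l (h - 1)..r g} \<subseteq> I" using ends sub by force
        ultimately show ?thesis by blast
      next
        case False
        \<comment> \<open>Here \<open>eps\<close> consists of the points from \<open>r g\<close> to
          \<open>l (h - 1)\<close>; the witness is the first of them that is not below
          \<open>?a\<close>.\<close>
        then have "{max ?a (r g)} \<in> separators S" using eps ends by (auto simp: eps_def)
        moreover have "max ?a (r g) \<in> I" using ends sub fin ab by (auto simp: max_def)
        ultimately show ?thesis by blast
      qed
    qed
  qed
qed

lemma up_separators:
  assumes S: "finite S" "S \<noteq> {}" "S \<subseteq> {..n}"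
  shows "up (separators S) = {I \<in> finite_intervals. \<forall>k\<in>S. \<not> I \<subseteq> gap k}"
proof -
  have "\<not> J \<subseteq> gap k" if J: "J \<in> separators S" and k: "k \<in> S" for J k
    using S J
  proof (cases rule: separators_cases)
    case (point x)
    then show ?thesis using k by auto
  next
    case (interval g h)
    have gh: "g < h" "h \<le> n" "k \<le> g \<or> h \<le> k" "k \<le> n"
      using interval k S by (auto simp: consecutive_def)
    \<comment> \<open>The right end of the separator excludes the gaps up to \<open>g\<close>, its
      left end those from \<open>h\<close> on.\<close>
    then have "r g \<in> right g" "l (h - 1) \<in> left h" by (auto simp: left_def right_def)
    then have "r g \<in> right k \<or> l (h - 1) \<in> left k"
      using gh left_mono[of h k] right_antimono[of k g] by auto
    then show ?thesis using interval unfolding gap_def by auto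
  qed
  then show ?thesis
    using separators_below[OF S] unfolding up_def by blast
qed

lemma separators_antichain:
  assumes S: "finite S" "S \<noteq> {}" "S \<subseteq> {..n}"
  shows "separators S \<in> interval_antichains"
proof -
  have "I \<in> finite_intervals" if "I \<in> separators S" for I
    using S that
    by (cases rule: separators_cases)
      (simp_all add: interval_in_finite_intervals singleton_in_finite_intervals)
  moreover have "I = J" if I: "I \<in> separators S" and J: "J \<in> separators S" and "I \<subseteq> J" for I J
    using S J
  proof (cases rule: separators_cases)
    case (point y)
    show ?thesis using S I
    proof (cases rule: separators_cases)
      case (point x)
      then show ?thesis using \<open>J = {y}\<close> \<open>I \<subseteq> J\<close> by simp
    next
      case (interval g h)
      then have "l (h - 1) \<in> J" "r g \<in> J" using \<open>I \<subseteq> J\<close> by auto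
      then show ?thesis using interval \<open>J = {y}\<close> by auto
    qed
  next
    case J: (interval g h)
    have gh: "g \<in> S" "h \<in> S" "g < h" "h \<le> n" using J S by (auto simp: consecutive_def)
    show ?thesis using S I
    proof (cases rule: separators_cases)
      case (point x)
      then have x: "l (h - 1) \<le> x" "x \<le> r g" "x \<notin> gap g" "x \<notin> gap h"
        using J gh \<open>I \<subseteq> J\<close> by auto
      \<comment> \<open>A point separator inside an interval separator would have to avoid gap
        \<open>g\<close>, which forces it to be \<open>r g\<close>; but \<open>r g\<close> lies in
        gap \<open>h\<close>.\<close>
      have "l (g - 1) < l (h - 1)" if "0 < g" using gh that by (intro l_less) auto
      then have "x \<notin> left g" using x by (auto simp: left_def)
      then have "x = r g" using x by (auto simp: gap_def right_def)
      then have "x \<notin> left h" using J by (auto simp: left_def)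
      moreover have "x \<notin> right h" using \<open>x = r g\<close> gh r_less[of g h] by (auto simp: right_def)
      ultimately show ?thesis using x by (auto simp: gap_def)
    next
      case I: (interval g' h')
      have gh': "g' \<in> S" "h' \<in> S" "g' < h'" "h' \<le> n" using I S by (auto simp: consecutive_def)
      \<comment> \<open>Inclusion moves the left end up and the right end down, so
        \<open>g' <= g < h <= h'\<close> by strict growth; as both pairs are neighbours in
        \<open>S\<close>, they coincide.\<close>
      have "l (h - 1) \<le> l (h' - 1)" "r g' \<le> r g" using I J \<open>I \<subseteq> J\<close> by auto
      moreover have "l (h' - 1) < l (h - 1)" if "h' < h" using gh gh' that by (intro l_less) auto
      moreover have "r g < r g'" if "g < g'" using gh' that by (intro r_less) auto
      ultimately have "\<not> h' < h" "\<not> g < g'" by auto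
      then have "h \<le> h'" "g' \<le> g" by auto
      moreover have "h \<le> g' \<or> h' \<le> h" "g \<le> g' \<or> h' \<le> g"
        using I gh by (auto simp: consecutive_def)
      ultimately have "h = h'" "g = g'" using gh by auto
      then show ?thesis using I J by simp
    qed
  qed
  ultimately show ?thesis unfolding interval_antichains_def by blast
qed

text \<open>For empty \<open>S\<close> no gap imposes a condition, every finite interval qualifies,
  and the result is the top element.\<close>

lemma rel_pseudo_compl_separators:
  assumes A: "A \<in> interval_antichains" "{} \<notin> A"
    and B: "{{l i..r i} | i. i < n} \<in> interval_antichains"
    and S: "S = {g. g \<le> n \<and> {gap g} \<sqsubseteq>\<^bsub>EO\<^esub> A}"
  shows "A \<rightarrow>\<^sub>H {{l i..r i} | i. i < n} = (if S = {} then {{}} else separators S)"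
proof (rule rel_pseudo_compl_eqI[OF A(1) B])
  have S': "finite S" "S \<subseteq> {..n}" using S finite_subset[of S "{..n}"] by auto
  have top: "{{}} \<in> interval_antichains"
    by (auto simp: interval_antichains_def finite_intervals_def order_interval_def)
  then show "(if S = {} then {{}} else separators S) \<in> interval_antichains"
    using separators_antichain S' by auto
  have "up (if S = {} then {{}} else separators S)
      = {I \<in> finite_intervals. \<forall>k\<in>S. \<not> I \<subseteq> gap k}"
    using up_separators S' by (auto simp: up_def)
  also have "\<dots> = {I \<in> finite_intervals.
      \<forall>J\<in>finite_intervals. I \<subseteq> J \<longrightarrow> J \<in> up A \<longrightarrow> J \<in> up {{l i..r i} | i. i < n}}"
    using heyting_up_iff[OF A] S by auto
  finally show "up (if S = {} then {{}} else separators S)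
      = {I \<in> finite_intervals.
        \<forall>J\<in>finite_intervals. I \<subseteq> J \<longrightarrow> J \<in> up A \<longrightarrow> J \<in> up {{l i..r i} | i. i < n}}" .
qed

end

section \<open>The explicit formula, by cases on the two end gaps\<close>

theorem theorem23:
  fixes A B :: "'a::linorder set set"
    and l r :: "nat \<Rightarrow> 'a"
    and n :: nat
    and T Tplus :: "nat set"
    and tmin tmax :: nat
    and P :: "nat \<Rightarrow> nat"
    and Uminus Uplus :: "'a set set"
  assumes locally_finite: "\<And>a b :: 'a. finite {a..b}"
    and A: "A \<in> carrier EO" "A \<noteq> {{}}"
    and B: "B \<in> carrier EO" "B \<noteq> {}" "B \<noteq> {{}}" "finite B"
    and B_eq: "B = {{l i..r i} | i. i < n}"
    and l_mono: "strict_mono_on {..<n} l"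
    and T: "T = {i. 0 < i \<and> i < n \<and> {{l (i - 1)<..<r i}} \<sqsubseteq>\<^bsub>EO\<^esub> A}"
    and tmin: "tmin = Min T"
    and tmax: "tmax = Max T"
    and Tplus: "Tplus = T - {tmin}"
    and P: "\<And>i. i \<in> Tplus \<Longrightarrow> P i = Max {j \<in> T. j < i}"
    and Uminus: "Uminus = (if {{..<r 0}} \<sqsubseteq>\<^bsub>EO\<^esub> A
                   then eps (l (tmin - 1)) (r 0)
                   else singletons_outside {l (tmin - 1)<..})"
    and Uplus: "Uplus = (if {{l (n - 1)<..}} \<sqsubseteq>\<^bsub>EO\<^esub> A
                   then eps (l (n - 1)) (r tmax)
                   else singletons_outside {..<r tmax})"
  shows "(T \<noteq> {} \<longrightarrow>
            A \<rightarrow>\<^sub>H B = Uminus \<union> (\<Union>i\<in>Tplus. eps (l (i - 1)) (r (P i))) \<union> Uplus)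
       \<and> (T = {} \<longrightarrow>
            A \<rightarrow>\<^sub>H B =
              (if {{l (n - 1)<..}} \<sqsubseteq>\<^bsub>EO\<^esub> A \<and> {{..<r 0}} \<sqsubseteq>\<^bsub>EO\<^esub> A then eps (l (n - 1)) (r 0)
               else if {{l (n - 1)<..}} \<sqsubseteq>\<^bsub>EO\<^esub> A then singletons_outside {l (n - 1)<..}
               else if {{..<r 0}} \<sqsubseteq>\<^bsub>EO\<^esub> A then singletons_outside {..<r 0}
               else {{}}))"
proof -
  have A': "A \<in> interval_antichains" and B': "B \<in> interval_antichains" using A(1) B(1) by simp_all
  have top: "C = {{}}" if "C \<in> interval_antichains" "{} \<in> C" for C :: "'a set set"
    using that unfolding interval_antichains_def by blast
  have A_ne: "{} \<notin> A" using top[OF A'] A(2) by blast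
  have B_ne: "{} \<notin> B" using top[OF B'] B(3) by blast
  have in_B: "{l i..r i} \<in> B" if "i < n" for i using that B_eq by blast
  have lr: "l i \<le> r i" if "i < n" for i using in_B[OF that] B_ne by (metis atLeastatMost_empty not_le)
  have ll: "l i < l j" if "i < j" "j < n" for i j
    using l_mono that by (auto simp: strict_mono_on_def)
  have rr: "r i < r j" if "i < j" "j < n" for i j
  proof (rule ccontr)
    assume "\<not> r i < r j"
    \<comment> \<open>If the right ends failed to increase, two members of \<open>B\<close> would be
      nested and hence equal, against the different left ends.\<close>
    then have "{l j..r j} \<subseteq> {l i..r i}" using ll[OF that] by auto
    moreover have "{l i..r i} \<in> B" "{l j..r j} \<in> B" using in_B that by simp_all
    ultimately have "{l j..r j} = {l i..r i}"
      using B' unfolding interval_antichains_def by blast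
    then have "l i \<in> {l j..r j}" using lr[of i] that by auto
    then show False using ll[OF that] by auto
  qed
  interpret interval_chain l r n using locally_finite ll rr lr by unfold_locales
  have n: "0 < n" using B(2) B_eq by auto
  define b0 where "b0 \<longleftrightarrow> {{..<r 0}} \<sqsubseteq>\<^bsub>EO\<^esub> A"
  define bn where "bn \<longleftrightarrow> {{l (n - 1)<..}} \<sqsubseteq>\<^bsub>EO\<^esub> A"
  define S where "S = {g. g \<le> n \<and> {gap g} \<sqsubseteq>\<^bsub>EO\<^esub> A}"
  have gap0: "gap 0 = {..<r 0}" using n by (auto simp: gap_def left_def right_def)
  have gapn: "gap n = {l (n - 1)<..}" using n by (auto simp: gap_def left_def right_def)
  have gap_mid: "gap i = {l (i - 1)<..<r i}" if "0 < i" "i < n" for i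
    using that by (auto simp: gap_def left_def right_def)
  have left_0: "left 0 = {}" and right_n: "right n = {}" by (auto simp: left_def right_def)
  have left_pos: "(\<lambda>x. {x}) ` left i = singletons_outside {l (i - 1)<..}" if "0 < i" for i
    using that by (auto simp: left_def singletons_outside_def)
  have right_less: "(\<lambda>x. {x}) ` right i = singletons_outside {..<r i}" if "i < n" for i
    using that by (auto simp: right_def singletons_outside_def)
  \<comment> \<open>The middle gaps counted by \<open>S\<close> are exactly those of
    \<open>T\<close>, so only the two end gaps remain to be decided.\<close>
  have S_eq: "S = (if bn then {n} else {}) \<union> (if b0 then {0} else {}) \<union> T"
  proof (rule Set.set_eqI)
    fix g
    consider "g = 0" | "0 < g" "g < n" | "g = n" | "n < g" by linarith
    then show "g \<in> S \<longleftrightarrow> g \<in> (if bn then {n} else {}) \<union> (if b0 then {0} else {}) \<union> T"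
      using n by cases (auto simp: S_def T b0_def bn_def gap0 gapn gap_mid)
  qed
  have main: "A \<rightarrow>\<^sub>H B = (if S = {} then {{}} else separators S)"
    using rel_pseudo_compl_separators[OF A' A_ne _ S_def] B' B_eq by simp
  have T_sub: "finite T" "\<And>t. t \<in> T \<Longrightarrow> 0 < t \<and> t < n" using T by auto
  show ?thesis
  proof (intro conjI impI)
    assume ne: "T \<noteq> {}"
    have t: "0 < tmin" "tmin < n" "0 < tmax" "tmax < n"
      using T_sub(2)[OF Min_in[OF T_sub(1) ne]] T_sub(2)[OF Max_in[OF T_sub(1) ne]]
      by (simp_all add: tmin tmax)
    let ?M = "\<Union>i\<in>Tplus. eps (l (i - 1)) (r (P i))"
    have M: "(\<Union>(g, h)\<in>consecutive T. eps (l (h - 1)) (r g)) = ?M"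
      unfolding consecutive_eq[OF T_sub(1) ne] using P by (simp add: Tplus tmin)
    have c0: "consecutive (insert 0 T) = insert (0, tmin) (consecutive T)"
      unfolding tmin by (rule consecutive_insert_less[OF T_sub(1) ne]) (simp add: T_sub)
    have cn: "consecutive (insert n T) = insert (tmax, n) (consecutive T)"
      unfolding tmax by (rule consecutive_insert_greater[OF T_sub(1) ne]) (simp add: T_sub)
    have mins: "Min (insert 0 T) = 0" "Min (insert n T) = tmin" "Min (insert 0 (insert n T)) = 0"
      "Max (insert 0 T) = tmax" "Max (insert n T) = n" "Max (insert 0 (insert n T)) = n"
      using T_sub(1) ne t tmin tmax by simp_all
    have c0n: "consecutive (insert 0 (insert n T))
        = insert (0, tmin) (insert (tmax, n) (consecutive T))"
    proof (subst consecutive_insert_less)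
      show "insert (0, Min (insert n T)) (consecutive (insert n T))
          = insert (0, tmin) (insert (tmax, n) (consecutive T))"
        by (simp only: mins cn)
    qed (use T_sub n in auto)
    \<comment> \<open>If \<open>0\<close> is in \<open>S\<close>, the set \<open>left 0\<close> is
      empty and the new pair \<open>(0, tmin)\<close> gives the \<open>eps\<close> form of
      \<open>Uminus\<close>; otherwise \<open>tmin\<close> is the minimum and
      \<open>left tmin\<close> gives the singletons. The right side is symmetric.\<close>
    have "separators S = Uminus \<union> ?M \<union> Uplus"
      unfolding S_eq separators_def Uminus Uplus b0_def[symmetric] bn_def[symmetric] M[symmetric]
      using t by (cases b0; cases bn)
        (auto simp: c0 cn c0n mins left_0 right_n left_pos right_less tmin[symmetric] tmax[symmetric])
    moreover have "S \<noteq> {}" using ne S_eq by auto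
    ultimately show "A \<rightarrow>\<^sub>H B = Uminus \<union> ?M \<union> Uplus" using main by simp
  next
    assume empty: "T = {}"
    \<comment> \<open>With \<open>T\<close> empty, two gaps can be neighbours only if both end gaps
      are present.\<close>
    have c: "consecutive {0, n} = {(0, n)}"
      using consecutive_insert_less[of "{n}" 0] n by simp
    show "A \<rightarrow>\<^sub>H B = (if {{l (n - 1)<..}} \<sqsubseteq>\<^bsub>EO\<^esub> A \<and> {{..<r 0}} \<sqsubseteq>\<^bsub>EO\<^esub> A
          then eps (l (n - 1)) (r 0)
        else if {{l (n - 1)<..}} \<sqsubseteq>\<^bsub>EO\<^esub> A then singletons_outside {l (n - 1)<..}
        else if {{..<r 0}} \<sqsubseteq>\<^bsub>EO\<^esub> A then singletons_outside {..<r 0}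
        else {{}})"
      unfolding main S_eq separators_def b0_def[symmetric] bn_def[symmetric] empty
      using n by (cases b0; cases bn) (simp_all add: c left_0 right_n left_pos right_less)
  qed
qed

end
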